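(* Let $(\xi_1,a_1,\xi_2,a_2)\in C^0_1$, i.e. $(\xi_i,a_i)\in\Sigma_i$ for $i\in\{1,2\}$ and $U_1(\xi_1,a_1)=U_2(\xi_2,a_2)$, and set $R_0:=U_1(\xi_1,a_1)=U_2(\xi_2,a_2)$. Suppose that for every $i\in\{1,2\}$ the following holds: for every $(\eta_i,\beta_i)\in\Sigma_i$ with $U_i(\eta_i,\beta_i)=R_0$, one has $\alpha_i(\eta_i)>0$. Then the following statements are equivalent: (i) $(\xi_1,a_1),(\xi_2,a_2)$ is a Nash equilibrium of the PPA game. (ii) $(\gamma_1,\gamma_2)$ is consistent with $(\xi_1,a_1,\xi_2,a_2)$, and there exists $i\in\{1,2\}$ such that $\mathbb{E}_i^{a_i}[X_i-\xi_i]\ge 0$, $(\xi_i,a_i)\in S(X_i,u_i,c_i,R_0)$, and one of the following holds: (a) $\mathbb{E}_{-i}^{a_{-i}}[X_{-i}-\xi_{-i}]=0$ and $(\xi_{-i},a_{-i})\in S(X_{-i},u_{-i},c_{-i},R_0)$; (b) $\mathbb{E}_{-i}^{a_{-i}}[X_{-i}-\xi_{-i}]<0$ and $V(X_{-i},u_{-i},c_{-i},R_0)\le 0$.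
   Context: Setting. $(\Omega,\mathcal F,\mathbb P)$ is a probability space carrying two independent real random variables $X_1,X_2$. For $i\in\{1,2\}$, $-i$ denotes the other index. For each $i$: $A_i\subset\mathbb R$ is a nonempty compact set; for each $a\in A_i$, $\mathbb P_i^a$ is a probability measure (absolutely continuous with respect to $\mathbb P$) describing the distribution of $X_i$ under effort $a$, with expectation $\mathbb E_i^a$; $u_i:\mathbb R\to\mathbb R$ is strictly increasing, concave and differentiable; $c_i:A_i\to\mathbb R$ is increasing and convex; $\Xi_i$ is a set of real $\sigma(X_i)$-measurable random variables (contracts), with $0\in\Xi_1\cap\Xi_2$. Upper-gap: for $\xi\in\Xi_i$, $\alpha_i(\xi):=\sup\{\delta\in\mathbb R: u_i(\xi)+\delta\le \sup u_i(\mathbb R)\ \mathbb P\text{-a.s.}\}\in[0,+\infty]$. Admissibility of $\Xi_i$: for all $\xi\in\Xi_i$ and $a\in A_i$, the variables $X_i,\xi,u_i(\xi)$ are $\mathbb P_i^a$-integrable; and for every $\xi\in\Xi_i$ and every real $\delta<\alpha_i(\xi)$, the perturbed contract $u_i^{-1}(u_i(\xi)+\delta)$ belongs to $\Xi_i$. Define $U_i(\xi,a):=\mathbb E_i^a[u_i(\xi)-c_i(a)]$ and $\Sigma_i:=\{(\xi,a)\in\Xi_i\times A_i: a\in\operatorname{arg\,max}_{b\in A_i}U_i(\xi,b)\}$. Partition: $C_i^0,C_i^i,C_i^{-i}$ are the sets of $(\xi_i,a_i,\xi_{-i},a_{-i})\in\Sigma_i\times\Sigma_{-i}$ with respectively $U_i(\xi_i,a_i)=U_{-i}(\xi_{-i},a_{-i})$,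 $U_i(\xi_i,a_i)>U_{-i}(\xi_{-i},a_{-i})$, $U_i(\xi_i,a_i)<U_{-i}(\xi_{-i},a_{-i})$. PPA game: fixed biases $\gamma_1,\gamma_2\in[0,1]$ with $\gamma_1+\gamma_2=1$. Principal $i$ chooses $(\xi_i,a_i)\in\Sigma_i$; her payoff $J_i(X_i,(\xi_i,a_i),(\xi_{-i},a_{-i}),\gamma_i)$ equals $\mathbb E_i^{a_i}[X_i-\xi_i]$ on $C_i^i$, $\gamma_i\mathbb E_i^{a_i}[X_i-\xi_i]$ on $C_i^0$, and $0$ on $C_i^{-i}$. $BR_i(\xi_{-i},a_{-i})\subset\Sigma_i$ is the (possibly empty) set of maximizers of $J_i(X_i,\cdot,(\xi_{-i},a_{-i}),\gamma_i)$ over $\Sigma_i$. A Nash equilibrium is a pair $(\xi_1,a_1)\in\Sigma_1$, $(\xi_2,a_2)\in\Sigma_2$ with $(\xi_1,a_1)\in BR_1(\xi_2,a_2)$ and $(\xi_2,a_2)\in BR_2(\xi_1,a_1)$. Consistency: for $(\xi_1,a_1,\xi_2,a_2)\in C_1^0$, $(\gamma_1,\gamma_2)$ is consistent with it if for every $i\in\{1,2\}$: $\mathbb E_i^{a_i}[X_i-\xi_i]<0\Rightarrow\gamma_i=0$, and $\mathbb E_i^{a_i}[X_i-\xi_i]>0\Rightarrow\gamma_i=1$. Individual problem: for $R\in\mathbb R$, $V(X_i,u_i,c_i,R):=\sup\{\mathbb E_i^a[X_i-\xi]:(\xi,a)\in\Sigma_i,\ U_i(\xi,a)\ge R\}$ (with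 $\sup\emptyset=-\infty$), and $S(X_i,u_i,c_i,R)$ is the set of pairs attaining this supremum. *)

theory Defs
  imports "HOL-Probability.Probability"
begin

datatype player = P1 | P2

primrec other :: "player \<Rightarrow> player" where
  "other P1 = P2"
| "other P2 = P1"

text \<open>The data \<open>(X\<^sub>i, A\<^sub>i, P\<^sub>i, u\<^sub>i, c\<^sub>i, \<Xi>\<^sub>i)\<close> of one principal-agent pair.\<close>

record 'w agency =
  outcome :: "'w \<Rightarrow> real"
  efforts :: "real set"
  law :: "real \<Rightarrow> 'w measure"
  utility :: "real \<Rightarrow> real"
  cost :: "real \<Rightarrow> real"
  contracts :: "('w \<Rightarrow> real) set"

text \<open>The effort set is not assumed to be an interval, whereas the library's \<open>convex_on\<close> forces its
  domain to be convex. Here the convexity inequality is required whenever the three points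
  involved lie in the domain; on a convex domain this is \<open>convex_on\<close>.\<close>

definition convex_fun_on :: "real set \<Rightarrow> (real \<Rightarrow> real) \<Rightarrow> bool" where
  "convex_fun_on A f \<longleftrightarrow>
     (\<forall>x\<in>A. \<forall>y\<in>A. \<forall>t\<in>{0..1}. (1 - t) * x + t * y \<in> A \<longrightarrow>
        f ((1 - t) * x + t * y) \<le> (1 - t) * f x + t * f y)"

definition upper_gap :: "'w measure \<Rightarrow> 'w agency \<Rightarrow> ('w \<Rightarrow> real) \<Rightarrow> ereal" where
  "upper_gap M G \<xi> =
     Sup {ereal \<delta> |\<delta>. AE \<omega> in M. ereal (utility G (\<xi> \<omega>) + \<delta>) \<le> (SUP x. ereal (utility G x))}"

text \<open>For \<open>\<delta>\<close> below the upper gap, \<open>u(\<xi>) + \<delta>\<close> lies in the range of \<open>u\<close> only almost surely, so that the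
  perturbed contract is defined up to a null set: some version of it has to be a contract.\<close>

definition admissible :: "'w measure \<Rightarrow> 'w agency \<Rightarrow> bool" where
  "admissible M G \<longleftrightarrow>
     (\<forall>\<xi>\<in>contracts G. \<forall>a\<in>efforts G.
        integrable (law G a) (outcome G) \<and>
        integrable (law G a) \<xi> \<and>
        integrable (law G a) (\<lambda>\<omega>. utility G (\<xi> \<omega>))) \<and>
     (\<forall>\<xi>\<in>contracts G. \<forall>\<delta>::real. ereal \<delta> < upper_gap M G \<xi> \<longrightarrow>
        (\<exists>\<eta>\<in>contracts G. AE \<omega> in M. \<eta> \<omega> = inv (utility G) (utility G (\<xi> \<omega>) + \<delta>)))"

definition agency_model :: "'w measure \<Rightarrow> 'w agency \<Rightarrow> bool" where
  "agency_model M G \<longleftrightarrow>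
     efforts G \<noteq> {} \<and> compact (efforts G) \<and>
     (\<forall>a\<in>efforts G. prob_space (law G a) \<and> sets (law G a) = sets M \<and>
        absolutely_continuous M (law G a)) \<and>
     strict_mono (utility G) \<and> concave_on UNIV (utility G) \<and>
     utility G differentiable_on UNIV \<and>
     mono_on (efforts G) (cost G) \<and> convex_fun_on (efforts G) (cost G) \<and>
     contracts G \<subseteq> borel_measurable (vimage_algebra (space M) (outcome G) borel) \<and>
     (\<lambda>_. 0) \<in> contracts G \<and>
     admissible M G"

definition ppa_model :: "'w measure \<Rightarrow> (player \<Rightarrow> 'w agency) \<Rightarrow> bool" where
  "ppa_model M G \<longleftrightarrow>
     prob_space M \<and>
     prob_space.indep_var M borel (outcome (G P1)) borel (outcome (G P2)) \<and>
     (\<forall>i. agency_model M (G i))"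

definition agent_utility :: "'w agency \<Rightarrow> ('w \<Rightarrow> real) \<times> real \<Rightarrow> real" where
  "agent_utility G = (\<lambda>(\<xi>, a). \<integral>\<omega>. (utility G (\<xi> \<omega>) - cost G a) \<partial>law G a)"

definition profit :: "'w agency \<Rightarrow> ('w \<Rightarrow> real) \<times> real \<Rightarrow> real" where
  "profit G = (\<lambda>(\<xi>, a). \<integral>\<omega>. (outcome G \<omega> - \<xi> \<omega>) \<partial>law G a)"

text \<open>The set \<open>\<Sigma>\<^sub>i\<close> of contracts together with an incentive compatible effort.\<close>

definition incentive_compatible :: "'w agency \<Rightarrow> (('w \<Rightarrow> real) \<times> real) set" where
  "incentive_compatible G =
     {(\<xi>, a). \<xi> \<in> contracts G \<and> is_arg_max (\<lambda>b. agent_utility G (\<xi>, b)) (\<lambda>b. b \<in> efforts G) a}"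

text \<open>The sets \<open>C\<^sub>i\<^sup>0\<close> and \<open>C\<^sub>i\<^sup>i\<close>; the remaining part \<open>C\<^sub>i\<^sup>-\<^sup>i\<close> is the complement of their union in
  \<open>\<Sigma>\<^sub>i \<times> \<Sigma>\<^sub>-\<^sub>i\<close>.\<close>

definition tie_set ::
  "(player \<Rightarrow> 'w agency) \<Rightarrow> player \<Rightarrow> ((('w \<Rightarrow> real) \<times> real) \<times> (('w \<Rightarrow> real) \<times> real)) set" where
  "tie_set G i =
     {(s, t) \<in> incentive_compatible (G i) \<times> incentive_compatible (G (other i)).
        agent_utility (G i) s = agent_utility (G (other i)) t}"

definition win_set ::
  "(player \<Rightarrow> 'w agency) \<Rightarrow> player \<Rightarrow> ((('w \<Rightarrow> real) \<times> real) \<times> (('w \<Rightarrow> real) \<times> real)) set" where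
  "win_set G i =
     {(s, t) \<in> incentive_compatible (G i) \<times> incentive_compatible (G (other i)).
        agent_utility (G i) s > agent_utility (G (other i)) t}"

definition payoff ::
  "(player \<Rightarrow> 'w agency) \<Rightarrow> (player \<Rightarrow> real) \<Rightarrow> player \<Rightarrow>
    ('w \<Rightarrow> real) \<times> real \<Rightarrow> ('w \<Rightarrow> real) \<times> real \<Rightarrow> real" where
  "payoff G \<gamma> i s t =
     (if (s, t) \<in> win_set G i then profit (G i) s
      else if (s, t) \<in> tie_set G i then \<gamma> i * profit (G i) s
      else 0)"

definition best_responses ::
  "(player \<Rightarrow> 'w agency) \<Rightarrow> (player \<Rightarrow> real) \<Rightarrow> player \<Rightarrow>
    ('w \<Rightarrow> real) \<times> real \<Rightarrow> (('w \<Rightarrow> real) \<times> real) set" where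
  "best_responses G \<gamma> i t =
     {s. is_arg_max (\<lambda>s'. payoff G \<gamma> i s' t) (\<lambda>s'. s' \<in> incentive_compatible (G i)) s}"

definition nash_equilibrium ::
  "(player \<Rightarrow> 'w agency) \<Rightarrow> (player \<Rightarrow> real) \<Rightarrow>
    ('w \<Rightarrow> real) \<times> real \<Rightarrow> ('w \<Rightarrow> real) \<times> real \<Rightarrow> bool" where
  "nash_equilibrium G \<gamma> s t \<longleftrightarrow>
     s \<in> incentive_compatible (G P1) \<and> t \<in> incentive_compatible (G P2) \<and>
     s \<in> best_responses G \<gamma> P1 t \<and> t \<in> best_responses G \<gamma> P2 s"

definition biases :: "(player \<Rightarrow> real) \<Rightarrow> bool" where
  "biases \<gamma> \<longleftrightarrow> (\<forall>i. \<gamma> i \<in> {0..1}) \<and> \<gamma> P1 + \<gamma> P2 = 1"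

definition consistent ::
  "(player \<Rightarrow> 'w agency) \<Rightarrow> (player \<Rightarrow> real) \<Rightarrow> (player \<Rightarrow> ('w \<Rightarrow> real) \<times> real) \<Rightarrow> bool" where
  "consistent G \<gamma> s \<longleftrightarrow>
     (\<forall>i. (profit (G i) (s i) < 0 \<longrightarrow> \<gamma> i = 0) \<and> (profit (G i) (s i) > 0 \<longrightarrow> \<gamma> i = 1))"

definition opt_value :: "'w agency \<Rightarrow> real \<Rightarrow> ereal" where
  "opt_value G R = (SUP s\<in>{s \<in> incentive_compatible G. agent_utility G s \<ge> R}. ereal (profit G s))"

definition opt_solutions :: "'w agency \<Rightarrow> real \<Rightarrow> (('w \<Rightarrow> real) \<times> real) set" where
  "opt_solutions G R =
     {s \<in> incentive_compatible G. agent_utility G s \<ge> R \<and> ereal (profit G s) = opt_value G R}"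

end

theory Submission
  imports Defs
begin

text \<open>Both agents' pairs give the same agent utility \<open>R\<^sub>0\<close>, and everything reduces to one numerical
  description of a best response at such a tie. Write \<open>p\<^sub>i\<close> for the profit of principal \<open>i\<close> and \<open>V\<^sub>i\<close>
  for the value of her individual problem at level \<open>R\<^sub>0\<close>; since her pair is feasible there,
  \<open>p\<^sub>i \<le> V\<^sub>i\<close>. The pair is a best response if and only if \<open>V\<^sub>i \<le> \<gamma>\<^sub>i p\<^sub>i\<close> and \<open>0 \<le> \<gamma>\<^sub>i p\<^sub>i\<close>
  (lemma \<open>best_response_at_tie_iff\<close>).

  The first inequality is needed because a principal who may offer a pair of profit \<open>q\<close> at level \<open>R\<^sub>0\<close>
  can get arbitrarily close to \<open>q\<close>, unshared: if the upper gap is positive, the agent can be given a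
  little more utility at little cost (lemma \<open>outbid_at_small_cost\<close>). The second one is needed because
  she can also give the agent less and lose the auction, for a payoff of zero. Both deviations come
  from lemma \<open>shifted_contract\<close>: adding a constant to the utility of a contract shifts the utility of
  every effort equally, and hence keeps the same efforts incentive compatible. Conversely, winning or tying
  pays at most \<open>max 0 V\<^sub>i\<close> and losing pays zero, so the two inequalities leave no profitable deviation.

  The two inequalities say that \<open>\<gamma>\<^sub>i = 1\<close> and \<open>V\<^sub>i = p\<^sub>i\<close> if \<open>p\<^sub>i > 0\<close>, that \<open>V\<^sub>i = 0\<close> if
  \<open>p\<^sub>i = 0\<close>, and that \<open>\<gamma>\<^sub>i = 0\<close> and \<open>V\<^sub>i \<le> 0\<close> if \<open>p\<^sub>i < 0\<close>. Because \<open>\<gamma>\<^sub>1 + \<gamma>\<^sub>2 = 1\<close>, the two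
  profits cannot both be positive nor both be negative, and the remaining sign patterns are those of
  the theorem.\<close>

text \<open>A concave strictly increasing function lies below its secant through \<open>0\<close> and \<open>1\<close> on the negative
  half-line, so it tends to \<open>-\<infinity>\<close> there and its range is a down-set.\<close>

lemma concave_strict_mono_range_downward:
  fixes u :: "real \<Rightarrow> real"
  assumes mono: "strict_mono u" and conc: "concave_on UNIV u" and cont: "continuous_on UNIV u"
    and le: "v \<le> u z"
  shows "v \<in> range u"
proof -
  define m where "m = u 1 - u 0"
  have m: "m > 0"
    using mono by (simp add: m_def strict_mono_def)
  have secant: "u (- y) \<le> u 0 - m * y" if y: "y > 0" for y
  proof -
    \<comment> \<open>The weight that makes \<open>0\<close> a convex combination of \<open>-y\<close> and \<open>1\<close>.\<close>
    define t where "t = y / (1 + y)"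
    have t: "0 \<le> t" "t \<le> 1" "(1 - t) * (- y) + t * 1 = 0"
      using y by (auto simp: t_def field_simps)
    have "(1 - t) * u (- y) + t * u 1 \<le> u 0"
      using concave_onD[OF conc, of t "- y" 1] t by simp
    then have "((1 - t) * u (- y) + t * u 1) * (1 + y) \<le> u 0 * (1 + y)"
      using y by (intro mult_right_mono) auto
    moreover have "((1 - t) * u (- y) + t * u 1) * (1 + y) =
        ((1 - t) * (1 + y)) * u (- y) + (t * (1 + y)) * u 1"
      by (simp add: algebra_simps)
    moreover have "(1 - t) * (1 + y) = 1" "t * (1 + y) = y"
      using y by (auto simp: t_def field_simps)
    ultimately have "u (- y) + y * u 1 \<le> u 0 * (1 + y)"
      by simp
    then show ?thesis
      by (simp add: m_def algebra_simps)
  qed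
  define y where "y = max (max 1 (- z)) ((u 0 - v) / m)"
  have y: "y > 0" "- y \<le> z" "(u 0 - v) / m \<le> y"
    by (auto simp: y_def)
  then have "u 0 - v \<le> m * y"
    using m by (simp add: field_simps)
  then have "u (- y) \<le> v"
    using secant[OF y(1)] by linarith
  then obtain x where "u x = v"
    using IVT'[of u "- y" v z] le y(2) continuous_on_subset[OF cont] by auto
  then show ?thesis
    by auto
qed

text \<open>Below the upper gap the shifted utility stays strictly below the supremum of \<open>u\<close>; hence it is a
  utility level that some payment attains.\<close>

lemma AE_shifted_utility_in_range:
  assumes model: "agency_model M G" and gap: "ereal \<delta> < upper_gap M G \<eta>"
  shows "AE \<omega> in M. utility G (\<eta> \<omega>) + \<delta> \<in> range (utility G)"
proof -
  obtain \<delta>' where \<delta>': "\<delta> < \<delta>'"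
    and ae: "AE \<omega> in M. ereal (utility G (\<eta> \<omega>) + \<delta>') \<le> (SUP x. ereal (utility G x))"
    using gap unfolding upper_gap_def less_Sup_iff by auto
  have u: "strict_mono (utility G)" "concave_on UNIV (utility G)"
    "continuous_on UNIV (utility G)"
    using model unfolding agency_model_def
    by (auto intro: differentiable_imp_continuous_on)
  from ae show ?thesis
  proof (eventually_elim)
    case (elim \<omega>)
    have "ereal (utility G (\<eta> \<omega>) + \<delta>) < ereal (utility G (\<eta> \<omega>) + \<delta>')"
      using \<delta>' by simp
    then have "ereal (utility G (\<eta> \<omega>) + \<delta>) < (SUP x. ereal (utility G x))"
      using elim by (rule less_le_trans)
    then obtain x where "utility G (\<eta> \<omega>) + \<delta> < utility G x"
      unfolding less_SUP_iff by auto
    then show ?case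
      using concave_strict_mono_range_downward[OF u, of _ x] by simp
  qed
qed

lemma upper_gap_nonneg: "0 \<le> upper_gap M G \<eta>"
  unfolding upper_gap_def by (rule Sup_upper) (auto intro!: exI[of _ 0] SUP_upper)

text \<open>Every effort has a law that is absolutely continuous with respect to \<open>M\<close>, so an \<open>M\<close>-almost sure
  shift of the utility by \<open>\<delta>\<close> moves the expected utility of all efforts by the same \<open>\<delta>\<close> and leaves the
  maximizers unchanged. Negative \<open>\<delta>\<close> are included; by \<open>upper_gap_nonneg\<close> they are always feasible.\<close>

lemma shifted_contract:
  assumes model: "agency_model M G" and \<eta>: "(\<eta>, \<beta>) \<in> incentive_compatible G"
    and gap: "ereal \<delta> < upper_gap M G \<eta>"
  obtains \<eta>' where "(\<eta>', \<beta>) \<in> incentive_compatible G"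
    and "AE \<omega> in M. utility G (\<eta>' \<omega>) = utility G (\<eta> \<omega>) + \<delta>"
    and "agent_utility G (\<eta>', \<beta>) = agent_utility G (\<eta>, \<beta>) + \<delta>"
proof -
  have \<eta>c: "\<eta> \<in> contracts G" and \<beta>: "\<beta> \<in> efforts G"
    and opt: "\<And>b. b \<in> efforts G \<Longrightarrow> agent_utility G (\<eta>, b) \<le> agent_utility G (\<eta>, \<beta>)"
    using \<eta> by (auto simp: incentive_compatible_def is_arg_max_def not_less)
  have adm: "admissible M G"
    using model by (simp add: agency_model_def)
  obtain \<eta>' where \<eta>'c: "\<eta>' \<in> contracts G"
    and inv: "AE \<omega> in M. \<eta>' \<omega> = inv (utility G) (utility G (\<eta> \<omega>) + \<delta>)"
    using adm \<eta>c gap unfolding admissible_def by blast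
  have ae: "AE \<omega> in M. utility G (\<eta>' \<omega>) = utility G (\<eta> \<omega>) + \<delta>"
    using inv AE_shifted_utility_in_range[OF model gap]
    by eventually_elim (simp add: f_inv_into_f)
  have shift: "agent_utility G (\<eta>', b) = agent_utility G (\<eta>, b) + \<delta>" if b: "b \<in> efforts G" for b
  proof -
    interpret L: prob_space "law G b"
      using model b by (simp add: agency_model_def)
    have ac: "absolutely_continuous M (law G b)" and sets: "sets (law G b) = sets M"
      using model b by (auto simp: agency_model_def)
    have int: "integrable (law G b) (\<lambda>\<omega>. utility G (\<eta> \<omega>))"
      "integrable (law G b) (\<lambda>\<omega>. utility G (\<eta>' \<omega>))"
      using adm \<eta>c \<eta>'c b by (auto simp: admissible_def)
    have "AE \<omega> in law G b. utility G (\<eta>' \<omega>) = utility G (\<eta> \<omega>) + \<delta>"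
      using absolutely_continuous_AE[OF sets ac ae] .
    then have "(\<integral>\<omega>. utility G (\<eta>' \<omega>) \<partial>law G b) = (\<integral>\<omega>. utility G (\<eta> \<omega>) + \<delta> \<partial>law G b)"
      using int by (intro integral_cong_AE) auto
    then show ?thesis
      using int by (simp add: agent_utility_def L.prob_space)
  qed
  have "(\<eta>', \<beta>) \<in> incentive_compatible G"
    using \<eta>'c \<beta> opt shift by (auto simp: incentive_compatible_def is_arg_max_def not_less)
  then show ?thesis
    using that ae shift[OF \<beta>] by blast
qed

text \<open>Continuity from below of the profit under small upward shifts. The inverse of \<open>u\<close> is convex, so
  the contract shifted by \<open>t \<delta>\<close> costs at most the mixture, with weights \<open>1 - t\<close> and \<open>t\<close>, of \<open>\<eta>\<close> and of
  the contract shifted by a fixed \<open>\<delta>\<close>. The latter is itself a contract, so its expected payment is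
  finite, and the mixture costs arbitrarily little more than \<open>\<eta>\<close> when \<open>t\<close> is small.\<close>

lemma outbid_at_small_cost:
  assumes model: "agency_model M G" and \<eta>: "(\<eta>, \<beta>) \<in> incentive_compatible G"
    and gap: "0 < upper_gap M G \<eta>" and \<epsilon>: "0 < \<epsilon>"
  obtains s where "s \<in> incentive_compatible G"
    and "agent_utility G (\<eta>, \<beta>) < agent_utility G s"
    and "profit G (\<eta>, \<beta>) - \<epsilon> < profit G s"
proof -
  obtain \<delta> where "0 < ereal \<delta>" and gap\<delta>: "ereal \<delta> < upper_gap M G \<eta>"
    using ereal_dense2[OF gap] by auto
  then have \<delta>: "0 < \<delta>"
    by simp
  obtain \<zeta> where \<zeta>: "(\<zeta>, \<beta>) \<in> incentive_compatible G"
    and \<zeta>u: "AE \<omega> in M. utility G (\<zeta> \<omega>) = utility G (\<eta> \<omega>) + \<delta>"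
    using shifted_contract[OF model \<eta> gap\<delta>] by metis
  define D where "D = \<bar>profit G (\<zeta>, \<beta>) - profit G (\<eta>, \<beta>)\<bar>"
  \<comment> \<open>Chosen such that the profit lost, at most \<open>t D\<close>, is below \<open>\<epsilon>\<close>.\<close>
  define t where "t = min 1 (\<epsilon> / (D + 1))"
  have D: "0 \<le> D"
    by (simp add: D_def)
  have t: "0 < t" "t \<le> 1"
    using \<epsilon> D by (auto simp: t_def)
  have "t * (D + 1) \<le> \<epsilon> / (D + 1) * (D + 1)"
    using D by (intro mult_right_mono) (auto simp: t_def)
  then have "t * (D + 1) \<le> \<epsilon>"
    using D by simp
  then have tD: "t * D < \<epsilon>"
    using t by (simp add: algebra_simps)
  have "t * \<delta> \<le> \<delta>"
    using t \<delta> by simp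
  then have "ereal (t * \<delta>) < upper_gap M G \<eta>"
    using gap\<delta> by (meson ereal_less_eq(3) le_less_trans)
  then obtain \<eta>' where \<eta>': "(\<eta>', \<beta>) \<in> incentive_compatible G"
    and \<eta>'u: "AE \<omega> in M. utility G (\<eta>' \<omega>) = utility G (\<eta> \<omega>) + t * \<delta>"
    and \<eta>'U: "agent_utility G (\<eta>', \<beta>) = agent_utility G (\<eta>, \<beta>) + t * \<delta>"
    using shifted_contract[OF model \<eta>] by metis
  have mono: "strict_mono (utility G)" and conc: "concave_on UNIV (utility G)"
    and adm: "admissible M G"
    using model by (auto simp: agency_model_def)
  have mix: "AE \<omega> in M. \<eta>' \<omega> \<le> (1 - t) * \<eta> \<omega> + t * \<zeta> \<omega>"
    using \<zeta>u \<eta>'u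
  proof eventually_elim
    case (elim \<omega>)
    have "utility G (\<eta>' \<omega>) = (1 - t) * utility G (\<eta> \<omega>) + t * utility G (\<zeta> \<omega>)"
      unfolding elim by (simp add: algebra_simps)
    also have "\<dots> \<le> utility G ((1 - t) * \<eta> \<omega> + t * \<zeta> \<omega>)"
      using concave_onD[OF conc, of t "\<eta> \<omega>" "\<zeta> \<omega>"] t by simp
    finally show ?case
      using strict_mono_less_eq[OF mono] by simp
  qed
  have \<beta>: "\<beta> \<in> efforts G" and c: "\<eta> \<in> contracts G" "\<eta>' \<in> contracts G" "\<zeta> \<in> contracts G"
    using \<eta> \<eta>' \<zeta> by (auto simp: incentive_compatible_def is_arg_max_def)
  have ac: "absolutely_continuous M (law G \<beta>)" and sets: "sets (law G \<beta>) = sets M"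
    using model \<beta> by (auto simp: agency_model_def)
  have int: "integrable (law G \<beta>) (outcome G)" "integrable (law G \<beta>) \<eta>"
    "integrable (law G \<beta>) \<eta>'" "integrable (law G \<beta>) \<zeta>"
    using adm \<beta> c by (auto simp: admissible_def)
  have "AE \<omega> in law G \<beta>. \<eta>' \<omega> \<le> (1 - t) * \<eta> \<omega> + t * \<zeta> \<omega>"
    using absolutely_continuous_AE[OF sets ac mix] .
  then have "(\<integral>\<omega>. \<eta>' \<omega> \<partial>law G \<beta>) \<le> (\<integral>\<omega>. (1 - t) * \<eta> \<omega> + t * \<zeta> \<omega> \<partial>law G \<beta>)"
    using int by (intro integral_mono_AE) auto
  also have "\<dots> = (1 - t) * (\<integral>\<omega>. \<eta> \<omega> \<partial>law G \<beta>) + t * (\<integral>\<omega>. \<zeta> \<omega> \<partial>law G \<beta>)"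
    using int by simp
  finally have "(1 - t) * profit G (\<eta>, \<beta>) + t * profit G (\<zeta>, \<beta>) \<le> profit G (\<eta>', \<beta>)"
    using int by (simp add: profit_def algebra_simps)
  moreover have "t * (profit G (\<eta>, \<beta>) - profit G (\<zeta>, \<beta>)) \<le> t * D"
    using t by (intro mult_left_mono) (auto simp: D_def)
  ultimately have "profit G (\<eta>, \<beta>) - \<epsilon> < profit G (\<eta>', \<beta>)"
    using tD by (simp add: algebra_simps)
  then show ?thesis
    using that[OF \<eta>'] \<eta>'U t \<delta> by simp
qed

lemma best_response_at_tie_iff:
  assumes model: "agency_model M (G i)" and bias: "\<gamma> i \<in> {0..1}"
    and s: "s \<in> incentive_compatible (G i)" "agent_utility (G i) s = R"
    and t: "t \<in> incentive_compatible (G (other i))" "agent_utility (G (other i)) t = R"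
    and gap: "\<And>\<eta> \<beta>. (\<eta>, \<beta>) \<in> incentive_compatible (G i) \<Longrightarrow>
        agent_utility (G i) (\<eta>, \<beta>) = R \<Longrightarrow> upper_gap M (G i) \<eta> > 0"
  shows "s \<in> best_responses G \<gamma> i t \<longleftrightarrow>
    opt_value (G i) R \<le> ereal (\<gamma> i * profit (G i) s) \<and> 0 \<le> \<gamma> i * profit (G i) s"
proof -
  let ?IC = "incentive_compatible (G i)" and ?U = "agent_utility (G i)"
    and ?p = "profit (G i)" and ?J = "\<gamma> i * profit (G i) s"
  have pay: "payoff G \<gamma> i r t = (if ?U r > R then ?p r else if ?U r = R then \<gamma> i * ?p r else 0)"
    if "r \<in> ?IC" for r
    using that t by (auto simp: payoff_def win_set_def tie_set_def)
  have br: "s \<in> best_responses G \<gamma> i t \<longleftrightarrow> (\<forall>r\<in>?IC. payoff G \<gamma> i r t \<le> ?J)"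
    using s by (auto simp: best_responses_def is_arg_max_def pay not_less)
  have opt: "opt_value (G i) R \<le> ereal ?J \<longleftrightarrow> (\<forall>r\<in>?IC. R \<le> ?U r \<longrightarrow> ?p r \<le> ?J)"
    unfolding opt_value_def SUP_le_iff by auto
  show ?thesis
    unfolding br opt
  proof (intro iffI conjI ballI impI)
    assume best: "\<forall>r\<in>?IC. payoff G \<gamma> i r t \<le> ?J"
    have win: "?p r \<le> ?J" if "r \<in> ?IC" "R < ?U r" for r
      using best that pay[of r] by auto
    show "?p r \<le> ?J" if r: "r \<in> ?IC" "R \<le> ?U r" for r
    proof (cases "?U r = R")
      case True
      obtain \<eta> \<beta> where eq: "r = (\<eta>, \<beta>)"
        by (cases r)
      have pos: "0 < upper_gap M (G i) \<eta>"
        using gap r(1) True unfolding eq by blast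
      show ?thesis
      proof (rule field_le_epsilon)
        fix \<epsilon> :: real
        assume "0 < \<epsilon>"
        then obtain r' where "r' \<in> ?IC" "?U r < ?U r'" "?p r - \<epsilon> < ?p r'"
          using outbid_at_small_cost[OF model r(1)[unfolded eq] pos] unfolding eq by metis
        then show "?p r \<le> ?J + \<epsilon>"
          using win[of r'] True by simp
      qed
    qed (use win r in auto)
    obtain \<eta> \<beta> where eq: "s = (\<eta>, \<beta>)"
      by (cases s)
    \<comment> \<open>Lowering the utility by one makes the principal lose the auction.\<close>
    have "ereal (- 1) < upper_gap M (G i) \<eta>"
      using upper_gap_nonneg[of M "G i" \<eta>] by (rule less_le_trans[rotated]) simp
    then obtain \<eta>' where "(\<eta>', \<beta>) \<in> ?IC" "?U (\<eta>', \<beta>) = R + - 1"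
      using shifted_contract[OF model s(1)[unfolded eq]] s(2) unfolding eq by metis
    then show "0 \<le> ?J"
      using best pay[of "(\<eta>', \<beta>)"] by auto
  next
    assume *: "(\<forall>r\<in>?IC. R \<le> ?U r \<longrightarrow> ?p r \<le> ?J) \<and> 0 \<le> ?J"
    fix r
    assume r: "r \<in> ?IC"
    \<comment> \<open>A share of a profit is at most the larger of that profit and zero.\<close>
    have "\<gamma> i * ?p r \<le> max 0 (?p r)"
      using bias by (cases "?p r \<ge> 0") (auto simp: mult_left_le_one_le mult_nonneg_nonpos max_def)
    then show "payoff G \<gamma> i r t \<le> ?J"
      using * r pay[OF r] by (auto simp: max_def split: if_splits)
  qed
qed

theorem theorem2p6:
  fixes M :: "'w measure"
    and G :: "player \<Rightarrow> 'w agency"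
    and \<gamma> :: "player \<Rightarrow> real"
    and \<xi> :: "player \<Rightarrow> 'w \<Rightarrow> real"
    and a :: "player \<Rightarrow> real"
    and R0 :: real
  assumes model: "ppa_model M G"
    and biases: "biases \<gamma>"
    and tie: "((\<xi> P1, a P1), (\<xi> P2, a P2)) \<in> tie_set G P1"
    and R0: "R0 = agent_utility (G P1) (\<xi> P1, a P1)"
    and gap: "\<And>i \<eta> \<beta>. (\<eta>, \<beta>) \<in> incentive_compatible (G i) \<Longrightarrow>
        agent_utility (G i) (\<eta>, \<beta>) = R0 \<Longrightarrow> upper_gap M (G i) \<eta> > 0"
  shows "nash_equilibrium G \<gamma> (\<xi> P1, a P1) (\<xi> P2, a P2) \<longleftrightarrow>
    consistent G \<gamma> (\<lambda>i. (\<xi> i, a i)) \<and>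
    (\<exists>i. profit (G i) (\<xi> i, a i) \<ge> 0 \<and>
       (\<xi> i, a i) \<in> opt_solutions (G i) R0 \<and>
       (profit (G (other i)) (\<xi> (other i), a (other i)) = 0 \<and>
          (\<xi> (other i), a (other i)) \<in> opt_solutions (G (other i)) R0 \<or>
        profit (G (other i)) (\<xi> (other i), a (other i)) < 0 \<and>
          opt_value (G (other i)) R0 \<le> 0))"
proof -
  let ?s = "\<lambda>i. (\<xi> i, a i)" and ?p = "\<lambda>i. profit (G i) (\<xi> i, a i)"
    and ?V = "\<lambda>i. opt_value (G i) R0"
  have all: "(\<forall>i. Q i) \<longleftrightarrow> Q P1 \<and> Q P2" and ex: "(\<exists>i. Q i) \<longleftrightarrow> Q P1 \<or> Q P2" for Q
    by (metis player.exhaust)+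
  have ic: "?s i \<in> incentive_compatible (G i)" and U: "agent_utility (G i) (?s i) = R0" for i
    using tie R0 by (cases i; auto simp: tie_set_def)+
  have \<gamma>: "0 \<le> \<gamma> i" "\<gamma> i \<le> 1" for i
    using biases by (auto simp: biases_def)
  have sum: "\<gamma> P1 + \<gamma> P2 = 1"
    using biases by (simp add: biases_def)
  have pV: "ereal (?p i) \<le> ?V i" for i
    unfolding opt_value_def using ic[of i] U[of i] by (intro SUP_upper) auto
  have br: "?s i \<in> best_responses G \<gamma> i (?s (other i)) \<longleftrightarrow>
      ?V i \<le> ereal (\<gamma> i * ?p i) \<and> 0 \<le> \<gamma> i * ?p i" for i
    using model \<gamma> ic U gap
    by (intro best_response_at_tie_iff[where M = M and R = R0]) (auto simp: ppa_model_def)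
  \<comment> \<open>The two inequalities, sorted by the sign of the profit.\<close>
  have br_cases: "?s i \<in> best_responses G \<gamma> i (?s (other i)) \<longleftrightarrow>
      (?p i < 0 \<longrightarrow> \<gamma> i = 0 \<and> ?V i \<le> 0) \<and> (?p i > 0 \<longrightarrow> \<gamma> i = 1) \<and>
      (?p i \<ge> 0 \<longrightarrow> ?V i = ereal (?p i))" for i
  proof (cases "?p i" "0 :: real" rule: linorder_cases)
    case less
    then have "0 \<le> \<gamma> i * ?p i \<longleftrightarrow> \<gamma> i = 0"
      using \<gamma>[of i] by (auto simp: zero_le_mult_iff)
    then show ?thesis
      using less unfolding br by (auto simp: zero_ereal_def)
  next
    case equal
    then show ?thesis
      using pV[of i] unfolding br by auto
  next
    case greater
    have "\<gamma> i = 1" if "?V i \<le> ereal (\<gamma> i * ?p i)"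
    proof -
      have "?p i \<le> \<gamma> i * ?p i"
        using order_trans[OF pV that] by simp
      then show ?thesis
        using greater \<gamma>[of i] by simp
    qed
    then show ?thesis
      using greater pV[of i] unfolding br by auto
  qed
  have sol: "?s i \<in> opt_solutions (G i) R0 \<longleftrightarrow> ?V i = ereal (?p i)" for i
    using ic[of i] U[of i] by (auto simp: opt_solutions_def)
  have nash: "nash_equilibrium G \<gamma> (?s P1) (?s P2) \<longleftrightarrow>
      (\<forall>i. ?s i \<in> best_responses G \<gamma> i (?s (other i)))"
    unfolding all nash_equilibrium_def using ic by simp
  show ?thesis
    unfolding nash br_cases all ex sol consistent_def other.simps
    using sum by (cases "?p P1" "0 :: real" rule: linorder_cases;
      cases "?p P2" "0 :: real" rule: linorder_cases) (auto simp: zero_ereal_def)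
qed

end
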